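(* Let $P$ be a positive integer and let $U_n = U_n(P,1)$. Consider the equation $U_n = 5x^2$ with integers $n\ge 1$ and $x$. (i) If $P$ is odd and $5\mid P$, then for $n\geq 1$ there is an integer $x$ with $U_n=5x^2$ if and only if $n=2$ and $P=5a^2$ for some integer $a$. (ii) If $P^2\equiv 1 \pmod 5$, then for $n\ge 1$ there is an integer $x$ with $U_n=5x^2$ if and only if $n=5$ and $P=1$. (iii) If $P$ is odd and $P^2\equiv -1 \pmod 5$, then there are no integers $n\ge 1$ and $x$ with $U_n=5x^2$.
   Context: For a positive integer $P$, the generalized Fibonacci sequence $U_n=U_n(P,1)$ is defined by $U_0=0$, $U_1=1$, and $U_{n+2}=PU_{n+1}+U_n$ for $n\ge 0$. *)

theory Defs
  imports "HOL-Number_Theory.Number_Theory"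
begin

(* gen_fib P n is the term U_n(P, 1); the second parameter is fixed to 1. *)
fun gen_fib :: "int \<Rightarrow> nat \<Rightarrow> int" where
  "gen_fib P 0 = 0"
| "gen_fib P (Suc 0) = 1"
| "gen_fib P (Suc (Suc n)) = P * gen_fib P (Suc n) + gen_fib P n"

end

theory Submission
  imports Defs "HOL-Computational_Algebra.Nth_Powers"
begin

text \<open>
  Write $U_n$ for \<^term>\<open>gen_fib P n\<close> and $V_n$ for its companion sequence, with $V_0 = 2$, $V_1 = P$ and
  the same recurrence. Then $V_n^2 = (P^2+4)U_n^2 + 4(-1)^n$, and $U_n$, $V_n$ have at most the
  common factor 2. The least index $r > 0$ with $5 \mid U_r$ is 2, 5 or 3 according to whether $P^2$ is
  0, 1 or $-1$ modulo 5, and $5 \mid U_n$ means $r \mid n$. So $U_n = 5x^2$ forces $n = rm$, and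

  \<^item> $U_{2m} = U_m V_m$,
  \<^item> $U_{5m} = U_m (V_m^4 - 3(-1)^m V_m^2 + 1)$,
  \<^item> $U_{3m} = U_m (V_m^2 - (-1)^m)$

  split $5x^2$ into nearly coprime factors, each of which is therefore a square times a small
  constant. Three elementary tools refute the resulting equations: congruences; the fact that
  $V_{2j} = V_j^2 \mp 2$ and its neighbours are too close to the square $V_j^2$ to be squares; and
  reflection of odd indices.

  Reflection replaces the quadratic reciprocity that is customary for such questions. If $n$ and $r$
  are distinct odd numbers and $P$ is odd, then some $V_{2^u}$ with $u > 0$ divides $U_n + U_r$
  (lemma \<open>gen_lucas_dvd_sum_odd_indices\<close>). As $V_{2^u} \equiv 3$ modulo 4, this number cannot
  divide $y^2 + z^2$ for $z$ a power of 2. With $r = 1$ it shows that $U_n$ is not a square for odd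
  $n > 1$, which is the heart of the case $5 \mid P$.

  If $P^2 \equiv 1$ modulo 5, one is led to $V^4 \mp 3V^2 + 1 = 5b^2$ with $V = V_m$. With the minus sign
  the left side factors. With the plus sign a Pell equation turns it into $5F_k - 6 = (2V)^2$ with
  a Fibonacci number of odd index $k$, and reflection against $F_3$ leaves only $V = 1$
  (lemma \<open>quartic_5_square\<close>), hence $m = 1$ and $P = 1$.

  If $5 \mid P$ and $m = 2j$ is even, then $U_m$ is ten times and $V_m$ twice a square. For even $j$ this is
  an infinite descent from $4j$ to $j$, and for odd $j$ it ends in the quartic $b^2 = 200e^4 + 1$.

  If $P^2 \equiv -1$ modulo 5, the equation reduces to $V_m^2 + 1 = 5b^2$, impossible modulo 8, or to
  $V_m^2 - 1 = cb^2$ with $c \in \{1, 3, 5, 15\}$ and $m$ even, which is refuted by halving the index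
  once or twice.
\<close>

section \<open>Squares: coprime factors, residues and gaps\<close>

lemma coprime_square_factor:
  fixes a b x :: int
  assumes "coprime a b" "a * b = x\<^sup>2" "a > 0"
  shows "\<exists>y. a = y\<^sup>2"
proof (cases "b = 0")
  case True
  with assms have "a = 1\<^sup>2" by simp
  then show ?thesis by blast
next
  case False
  have "a * b \<ge> 0" using assms(2) by simp
  with assms(3) False have "b > 0" by (simp add: zero_le_mult_iff)
  have "nat a * nat b = nat \<bar>x\<bar> ^ 2"
    using assms(2,3) \<open>b > 0\<close> by (metis nat_mult_distrib nat_power_eq abs_ge_zero order_less_imp_le power2_abs)
  moreover have "coprime (nat a) (nat b)"
    using assms(1,3) \<open>b > 0\<close> by (simp add: coprime_int_iff [symmetric])
  ultimately have "is_nth_power 2 (nat a)"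
    using is_nth_power_mult_coprime_natD(1)[of "nat a" "nat b" 2] assms(3) \<open>b > 0\<close>
    by (simp add: is_nth_power_def)
  then obtain y where "nat a = y ^ 2" by (auto simp: is_nth_power_def)
  then have "a = (int y)\<^sup>2" using assms(3) by (metis int_nat_eq of_nat_power order_less_imp_le)
  then show ?thesis by blast
qed

text \<open>The prime $p$ divides exactly one of the coprime factors; after it is cancelled the product is a
  square, and so is each factor.\<close>

lemma coprime_prime_times_square_factors:
  fixes a b x p :: int
  assumes "prime p" "coprime a b" "a * b = p * x\<^sup>2" "a > 0" "b > 0"
  shows "(\<exists>s t. a = s\<^sup>2 \<and> b = p * t\<^sup>2) \<or> (\<exists>s t. a = p * s\<^sup>2 \<and> b = t\<^sup>2)"
proof -
  have *: "\<exists>s t. c = p * s\<^sup>2 \<and> d = t\<^sup>2"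
    if cd: "coprime c d" "c * d = p * x\<^sup>2" "c > 0" "d > 0" "p dvd c" for c d :: int
  proof -
    have "p > 0" using assms(1) by (rule prime_gt_0_int)
    obtain e where e: "c = p * e" using cd(5) by (rule dvdE)
    have "e > 0" using e cd(3) \<open>p > 0\<close> by (simp add: zero_less_mult_iff)
    have ed: "e * d = x\<^sup>2" using cd(2) e \<open>p > 0\<close> by simp
    have cop: "coprime e d" using cd(1) e by simp
    show ?thesis
      using coprime_square_factor[OF cop ed \<open>e > 0\<close>]
        coprime_square_factor[of d e x] cop ed cd(4) e
      by (metis coprime_commute mult.commute)
  qed
  have "p dvd a * b" using assms(3) by simp
  then consider "p dvd a" | "p dvd b" using assms(1) prime_dvd_mult_iff by blast
  then show ?thesis
  proof cases
    case 1
    then show ?thesis using * assms by blast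
  next
    case 2
    then show ?thesis using *[of b a] assms by (metis coprime_commute mult.commute)
  qed
qed

lemma square_mod_4: "(x::int)\<^sup>2 mod 4 = (if even x then 0 else 1)"
proof -
  have "x mod 4 \<in> {0,1,2,3}" by auto
  then show ?thesis by (subst power_mod[symmetric]) (auto, presburger+)
qed

lemma square_mod_8: "(x::int)\<^sup>2 mod 8 \<in> {0,1,4}"
proof -
  have "x mod 8 \<in> {0,1,2,3,4,5,6,7}" by auto
  then show ?thesis by (subst power_mod[symmetric]) auto
qed

lemma odd_square_mod_8:
  assumes "odd (x::int)"
  shows "x\<^sup>2 mod 8 = 1"
proof -
  have "x mod 8 \<in> {1,3,5,7}" using assms by (simp, presburger)
  then show ?thesis by (subst power_mod[symmetric]) auto
qed

lemma square_mod_5: "(x::int)\<^sup>2 mod 5 \<in> {0,1,4}"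
proof -
  have "x mod 5 \<in> {0,1,2,3,4}" by auto
  then show ?thesis by (subst power_mod[symmetric]) auto
qed

lemma fourth_power_mod_5: "(x::int) ^ 4 mod 5 \<in> {0, 1}"
proof -
  have "x mod 5 \<in> {0,1,2,3,4}" by auto
  then show ?thesis by (subst power_mod[symmetric]) auto
qed

lemma five_times_square_mod_8: "5 * (x::int)\<^sup>2 mod 8 \<in> {0,4,5}"
  using square_mod_8[of x] by (subst mod_mult_right_eq[symmetric]) auto

lemma five_times_square_mod_16: "5 * (x::int)\<^sup>2 mod 16 \<noteq> 8"
proof
  assume *: "5 * x\<^sup>2 mod 16 = 8"
  have "even x"
  proof (rule ccontr)
    assume "odd x"
    then have "odd (5 * x\<^sup>2)" by simp
    then show False using * by (metis dvd_mod_iff even_numeral)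
  qed
  then obtain y where "x = 2 * y" by (rule evenE)
  then have "4 * (5 * y\<^sup>2) mod (4 * 4) = 8" using * by (simp add: power_mult_distrib)
  then have "5 * y\<^sup>2 mod 4 = 2" unfolding mult_mod_right[symmetric] by simp
  moreover have "5 * y\<^sup>2 mod 4 = y\<^sup>2 mod 4" using mod_mult_self2[of "y\<^sup>2" 4 "y\<^sup>2"] by simp
  ultimately show False using square_mod_4[of y] by (simp split: if_splits)
qed

lemma not_3_dvd_square_plus_1: "\<not> 3 dvd (x::int)\<^sup>2 + 1"
proof -
  have "x mod 3 \<in> {0,1,2}" by auto
  then have "x\<^sup>2 mod 3 \<in> {0,1}" by (subst power_mod[symmetric]) auto
  moreover define y where "y = x\<^sup>2"
  ultimately have "y mod 3 = 0 \<or> y mod 3 = 1" by simp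
  then show ?thesis unfolding y_def[symmetric] by presburger
qed

lemma consecutive_squares:
  fixes x y :: int
  assumes "x\<^sup>2 = y\<^sup>2 + 1"
  shows "y = 0"
proof -
  have "(\<bar>x\<bar> - \<bar>y\<bar>) * (\<bar>x\<bar> + \<bar>y\<bar>) = 1" using assms by (simp add: algebra_simps flip: power2_eq_square)
  then show ?thesis by (auto simp: zmult_eq_1_iff)
qed

text \<open>This is how an equation between squares is refuted below: whenever $s^2 = v^2 + d$ with $d \neq 0$
  small compared with $v$, the square $s^2$ would lie between neighbouring squares.\<close>

lemma square_eq_of_between:
  fixes s v :: int
  assumes "v \<ge> 1" "(v - 1)\<^sup>2 < s\<^sup>2" "s\<^sup>2 < (v + 1)\<^sup>2"
  shows "s\<^sup>2 = v\<^sup>2"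
proof -
  have "v - 1 < \<bar>s\<bar>" "\<bar>s\<bar> < v + 1"
    using assms power2_less_imp_less[of "v - 1" "\<bar>s\<bar>"] power2_less_imp_less[of "\<bar>s\<bar>" "v + 1"] by auto
  then have "\<bar>s\<bar> = v" by simp
  then show ?thesis by (metis power2_abs)
qed

lemma square_plus_small:
  fixes s v d :: int
  assumes "v \<ge> 3" "s\<^sup>2 = v\<^sup>2 + d" "\<bar>d\<bar> \<le> 4"
  shows "d = 0"
proof -
  have "s\<^sup>2 = v\<^sup>2"
    by (rule square_eq_of_between) (use assms in \<open>auto simp: power2_eq_square algebra_simps\<close>)
  then show ?thesis using assms(2) by simp
qed

section \<open>Sums of two squares modulo a number congruent to 3 modulo 4\<close>

text \<open>Otherwise $x^2 \equiv -y^2$ with both sides units. Raising this to the power $(p-1)/2$, which is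
  odd, turns it by Fermat's theorem into $1 \equiv -1$.\<close>

lemma prime_3_mod_4_dvd_sum_squares:
  fixes x y :: int and p :: nat
  assumes "prime p" "p mod 4 = 3" "int p dvd x\<^sup>2 + y\<^sup>2"
  shows "int p dvd x"
proof (rule ccontr)
  assume nx: "\<not> int p dvd x"
  have ny: "\<not> int p dvd y"
  proof
    assume "int p dvd y"
    then have "int p dvd y\<^sup>2" by (simp add: power2_eq_square)
    with assms(3) have "int p dvd x\<^sup>2" by (simp add: dvd_add_left_iff)
    then show False using nx assms(1) prime_dvd_power_int[of "int p"] by simp
  qed
  have fermat: "[z ^ (p - 1) = 1] (mod int p)" if "\<not> int p dvd z" for z :: int
  proof -
    have "p > 0" using assms(1) prime_gt_0_nat by blast
    have "\<not> p dvd nat (z mod int p)"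
      using that \<open>p > 0\<close>
      by (metis dvd_mod_iff dvd_refl int_dvd_int_iff int_nat_eq of_nat_0_less_iff pos_mod_sign)
    from fermat_theorem[OF assms(1) this]
    have "[int (nat (z mod int p)) ^ (p - 1) = 1] (mod int p)"
      by (metis cong_int_iff of_nat_1 of_nat_power)
    then have "[(z mod int p) ^ (p - 1) = 1] (mod int p)" using \<open>p > 0\<close> by simp
    then show ?thesis by (simp add: cong_def power_mod)
  qed
  define k where "k = (p - 1) div 2"
  have p1: "p - 1 = 2 * k" and "odd k" using assms(2) unfolding k_def by presburger+
  have "[x\<^sup>2 = - y\<^sup>2] (mod int p)" using assms(3) by (simp add: cong_iff_dvd_diff)
  then have "[(x\<^sup>2) ^ k = (- y\<^sup>2) ^ k] (mod int p)" by (rule cong_pow)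
  then have "[x ^ (p - 1) = - (y ^ (p - 1))] (mod int p)"
    using \<open>odd k\<close> unfolding p1 power_mult by simp
  moreover have "[- (y ^ (p - 1)) = -1] (mod int p)"
    using fermat[OF ny] by (simp add: cong_minus_minus_iff)
  ultimately have "[1 = (-1::int)] (mod int p)"
    using fermat[OF nx] by (meson cong_sym cong_trans)
  then have "int p dvd 2" by (simp add: cong_iff_dvd_diff)
  then have "p \<le> 2" by (metis zdvd_imp_le int_ops(3) of_nat_le_iff of_nat_numeral zero_less_numeral)
  with assms(2) show False using prime_gt_1_nat[OF assms(1)] by simp
qed

lemma prime_factor_3_mod_4:
  fixes N :: nat
  assumes "N mod 4 = 3"
  shows "\<exists>p. prime p \<and> p mod 4 = 3 \<and> p dvd N"
  using assms
proof (induction N rule: less_induct)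
  case (less N)
  then have "N \<noteq> 1" by auto
  then obtain p where p: "prime p" "p dvd N" using prime_factor_nat by blast
  then obtain M where M: "N = p * M" by (auto elim: dvdE)
  show ?case
  proof (cases "p mod 4 = 3")
    case True
    then show ?thesis using p by blast
  next
    case False
    have "odd N" using less.prems by presburger
    then have "odd p" using M by simp
    with False have "p mod 4 = 1" by presburger
    then have "M mod 4 = 3" using less.prems M by (metis mod_mult_left_eq mult_1)
    moreover have "M < N"
      using M prime_gt_1_nat[OF p(1)] \<open>odd N\<close> n_less_m_mult_n[of M p] by (cases "M = 0") auto
    ultimately show ?thesis using less.IH M by (metis dvd_mult)
  qed
qed

text \<open>This is applied with $y \in \{1, 4\}$. There $p \mid y$ is absurd for an odd prime $p$, so the lemma
  says that $-y^2$ is not a square modulo $N$. Working with a single prime factor of $N$ avoids the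
  Jacobi symbol.\<close>

lemma sum_squares_dvd_3_mod_4:
  fixes x y N :: int
  assumes "N > 0" "N mod 4 = 3" "N dvd x\<^sup>2 + y\<^sup>2"
  obtains p :: nat where "prime p" "p mod 4 = 3" "int p dvd x" "int p dvd y"
proof -
  have "nat N mod 4 = 3" using assms(1,2) by (simp add: nat_mod_distrib[symmetric] flip: nat_numeral)
  then obtain p where p: "prime p" "p mod 4 = 3" "p dvd nat N" using prime_factor_3_mod_4 by blast
  then have "int p dvd x\<^sup>2 + y\<^sup>2"
    using assms(1,3) by (metis dvd_trans int_dvd_int_iff int_nat_eq order_less_imp_le)
  then show ?thesis
    using that p prime_3_mod_4_dvd_sum_squares[of p x y] prime_3_mod_4_dvd_sum_squares[of p y x]
    by (simp add: add.commute)
qed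

section \<open>The companion sequence and multiplication of the index\<close>

text \<open>The companion sequence $V_n = V_n(P,1)$. With $\alpha, \beta$ the roots of $t^2 = P t + 1$ it is
  $\alpha^n + \beta^n$, while $U_n = (\alpha^n - \beta^n)/(\alpha - \beta)$.\<close>

fun gen_lucas :: "int \<Rightarrow> nat \<Rightarrow> int" where
  "gen_lucas P 0 = 2"
| "gen_lucas P (Suc 0) = P"
| "gen_lucas P (Suc (Suc n)) = P * gen_lucas P (Suc n) + gen_lucas P n"

lemma gen_lucas_eq: "gen_lucas P n = 2 * gen_fib P (Suc n) - P * gen_fib P n"
  by (induction P n rule: gen_lucas.induct) (auto simp: algebra_simps)

text \<open>In terms of the roots, multiply $\alpha^{n+k}$ by $\alpha^k + \beta^k$ and use
  $\alpha\beta = -1$. All multiplication formulas for the index come from this identity. It is stated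
  for an arbitrary solution $s$ of the recurrence because it is applied to $U$, to $V$, and to $U$
  continued to negative indices.\<close>

lemma linear_recurrence_double_shift:
  fixes s :: "nat \<Rightarrow> int"
  assumes rec: "\<And>n. s (n + 2) = P * s (n + 1) + s n"
  shows "s (n + 2 * k) + (-1) ^ k * s n = gen_lucas P k * s (n + k)"
proof (induction k arbitrary: n rule: fib.induct[case_names 0 1 step])
  case 0
  then show ?case by simp
next
  case 1
  then show ?case using rec[of n] by simp
next
  case (step k)
  have "gen_lucas P (Suc (Suc k)) * s (n + Suc (Suc k))
      = P * (gen_lucas P (Suc k) * s (Suc n + Suc k)) + gen_lucas P k * s (n + 2 + k)"
    by (simp add: algebra_simps)
  also have "\<dots> = P * (s (Suc n + 2 * Suc k) + (-1) ^ Suc k * s (Suc n))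
      + (s (n + 2 + 2 * k) + (-1) ^ k * s (n + 2))"
    unfolding step[symmetric] by simp
  also have "\<dots> = s (n + 2 * Suc (Suc k)) + (-1) ^ Suc (Suc k) * s n"
    using rec[of n] rec[of "n + 2 * k + 2"] by (simp add: algebra_simps)
  finally show ?case by simp
qed

lemma gen_fib_double_shift:
  "gen_fib P (n + 2 * k) = gen_lucas P k * gen_fib P (n + k) - (-1) ^ k * gen_fib P n"
  using linear_recurrence_double_shift[of "gen_fib P" P n k] by simp

lemma gen_lucas_double_shift:
  "gen_lucas P (n + 2 * k) = gen_lucas P k * gen_lucas P (n + k) - (-1) ^ k * gen_lucas P n"
  using linear_recurrence_double_shift[of "gen_lucas P" P n k] by simp

lemma gen_fib_double: "gen_fib P (2 * k) = gen_fib P k * gen_lucas P k"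
  using gen_fib_double_shift[of P 0 k] by simp

lemma gen_lucas_double: "gen_lucas P (2 * k) = (gen_lucas P k)\<^sup>2 - 2 * (-1) ^ k"
  using gen_lucas_double_shift[of P 0 k] by (simp add: power2_eq_square)

lemma gen_fib_triple: "gen_fib P (3 * m) = gen_fib P m * ((gen_lucas P m)\<^sup>2 - (-1) ^ m)"
proof -
  have "gen_fib P (3 * m) = gen_lucas P m * gen_fib P (2 * m) - (-1) ^ m * gen_fib P m"
    using gen_fib_double_shift[of P m m] by (simp flip: mult_2)
  then show ?thesis unfolding gen_fib_double by (simp add: algebra_simps power2_eq_square)
qed

lemma gen_fib_quintuple:
  "gen_fib P (5 * m) = gen_fib P m * ((gen_lucas P m) ^ 4 - 3 * (-1) ^ m * (gen_lucas P m)\<^sup>2 + 1)"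
proof -
  have e: "(-1::int) ^ m * (-1) ^ m = 1" by (simp flip: power_mult_distrib)
  have "gen_fib P (5 * m) = gen_lucas P (2 * m) * gen_fib P (3 * m) - gen_fib P m"
    using gen_fib_double_shift[of P m "2 * m"] by (simp add: algebra_simps)
  also have "\<dots> = gen_fib P m * ((gen_lucas P m) ^ 4 - 3 * (-1) ^ m * (gen_lucas P m)\<^sup>2
      + (2 * ((-1) ^ m * (-1) ^ m) - 1))"
    unfolding gen_lucas_double gen_fib_triple by (simp add: algebra_simps power2_eq_square power4_eq_xxxx)
  finally show ?thesis unfolding e by simp
qed

lemma gen_fib_cassini:
  "(gen_fib P (Suc n))\<^sup>2 - P * gen_fib P (Suc n) * gen_fib P n - (gen_fib P n)\<^sup>2 = (-1) ^ n"
proof (induction n)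
  case (Suc n)
  then show ?case by (simp add: algebra_simps power2_eq_square)
qed simp

lemma gen_lucas_square: "(gen_lucas P n)\<^sup>2 = (P\<^sup>2 + 4) * (gen_fib P n)\<^sup>2 + 4 * (-1) ^ n"
  using gen_fib_cassini[of P n] unfolding gen_lucas_eq
  by (simp add: algebra_simps power2_eq_square)

lemma gen_fib_pos:
  assumes "P > 0" "n > 0"
  shows "gen_fib P n > 0"
proof -
  have "gen_fib P n \<ge> 0 \<and> gen_fib P (Suc n) > 0" for n
    using assms(1) by (induction n) (auto simp: add_pos_nonneg)
  then show ?thesis using assms(2) by (metis gr0_conv_Suc)
qed

lemma gen_lucas_pos:
  assumes "P > 0"
  shows "gen_lucas P n > 0"
  using assms by (induction P n rule: gen_lucas.induct) (auto simp: add_pos_pos)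

lemma gen_lucas_ge_3:
  assumes "P > 0" "n \<ge> 2"
  shows "gen_lucas P n \<ge> 3"
  using assms(2)
proof (induction n rule: dec_induct)
  case base
  have "P * P \<ge> 1 * 1" using assms(1) by (intro mult_mono) auto
  then show ?case by (simp add: numeral_2_eq_2)
next
  case (step n)
  then obtain k where k: "n = Suc k" by (cases n) auto
  have "P * gen_lucas P n \<ge> 1 * gen_lucas P n" using assms(1) gen_lucas_pos[OF assms(1), of n]
    by (intro mult_right_mono) auto
  moreover have "gen_lucas P (Suc n) = P * gen_lucas P n + gen_lucas P k" using k by simp
  ultimately show ?case using step.IH gen_lucas_pos[OF assms(1), of k] by linarith
qed

lemma coprime_gen_fib_Suc: "coprime (gen_fib P n) (gen_fib P (Suc n))"
proof (induction n)
  case (Suc n)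
  then show ?case
    using gcd_add_mult[of "gen_fib P (Suc n)" P "gen_fib P n"]
    by (simp add: coprime_iff_gcd_eq_1 gcd.commute)
qed simp

section \<open>Divisibility of the terms\<close>

text \<open>Since $V_n = 2 U_{n+1} - P U_n$, a common divisor divides $2 U_{n+1}$, and $U_n$, $U_{n+1}$ are
  coprime.\<close>

lemma common_divisor_gen_fib_gen_lucas:
  assumes "d dvd gen_fib P n" "d dvd gen_lucas P n"
  shows "d dvd 2"
proof -
  have "d dvd 2 * gen_fib P (Suc n)"
    using assms unfolding gen_lucas_eq by (metis dvd_diffD1 dvd_mult dvd_diff_left_iff)
  moreover have "coprime d (gen_fib P (Suc n))"
    using coprime_gen_fib_Suc[of P n] assms(1) by (meson coprime_divisors dvd_refl)
  ultimately show ?thesis by (simp add: coprime_dvd_mult_left_iff)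
qed

lemma gen_fib_add:
  "gen_fib P (n + Suc r) = gen_fib P (Suc n) * gen_fib P (Suc r) + gen_fib P n * gen_fib P r"
proof (induction n arbitrary: r)
  case (Suc n)
  have "gen_fib P (Suc n + Suc r) = gen_fib P (n + Suc (Suc r))" by simp
  also have "\<dots> = gen_fib P (Suc n) * gen_fib P (Suc (Suc r)) + gen_fib P n * gen_fib P (Suc r)"
    by (rule Suc.IH)
  finally show ?case by (simp add: algebra_simps)
qed simp

text \<open>Here $r$ is the rank of apparition of $p$. By the addition formula,
  $U_{m+r} \equiv U_m U_{r-1}$ modulo $p$ with $p \nmid U_{r-1}$, so lowering the index by $r$ does not
  affect divisibility by $p$.\<close>

lemma prime_dvd_gen_fib_iff:
  assumes "prime p" "r > 0" "p dvd gen_fib P r" "\<And>i. 0 < i \<Longrightarrow> i < r \<Longrightarrow> \<not> p dvd gen_fib P i"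
  shows "p dvd gen_fib P n \<longleftrightarrow> r dvd n"
proof (induction n rule: less_induct)
  case (less n)
  show ?case
  proof (cases "n < r")
    case True
    then show ?thesis using assms(4)[of n] by (cases "n = 0") (auto dest: dvd_imp_le)
  next
    case False
    obtain q where q: "r = Suc q" using assms(2) gr0_conv_Suc by blast
    define m where "m = n - r"
    have n: "n = m + r" using False by (simp add: m_def)
    have "\<not> p dvd gen_fib P q"
      using coprime_gen_fib_Suc[of P q] assms(1,3) unfolding q
      by (meson coprime_common_divisor not_prime_unit)
    then have "p dvd gen_fib P n \<longleftrightarrow> p dvd gen_fib P m"
      using gen_fib_add[of P m q] assms(1,3) unfolding n q
      by (simp add: dvd_add_right_iff prime_dvd_mult_iff)
    then show ?thesis using less.IH[of m] assms(2) unfolding n by simp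
  qed
qed

text \<open>For even $k$ each shift of the index by $2k$ changes the sign modulo $V_k$. An odd number of shifts
  leaves one sign.\<close>

lemma gen_lucas_dvd_odd_shift:
  fixes s :: "nat \<Rightarrow> int"
  assumes rec: "\<And>n. s (n + 2) = P * s (n + 1) + s n" and "even k" "odd g"
  shows "gen_lucas P k dvd s (n + 2 * k * g) + s n"
proof -
  have *: "gen_lucas P k dvd s (n + 2 * k) + s n" for n
    using linear_recurrence_double_shift[OF rec, of n k] assms(2) by simp
  obtain h where g: "g = Suc (2 * h)" using assms(3) oddE by (metis Suc_eq_plus1)
  show ?thesis unfolding g
  proof (induction h)
    case 0
    then show ?case using *[of n] by simp
  next
    case (Suc h)
    let ?N = "n + 2 * k * Suc (2 * h)"
    have eq: "n + 2 * k * Suc (2 * Suc h) = ?N + 2 * k + 2 * k" by (simp add: algebra_simps)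
    have "s (?N + 2 * k + 2 * k) + s n
        = (s (?N + 2 * k + 2 * k) + s (?N + 2 * k)) - (s (?N + 2 * k) + s ?N) + (s ?N + s n)" by simp
    then show ?case unfolding eq using *[of ?N] *[of "?N + 2 * k"] Suc.IH
      by (metis dvd_add dvd_diff)
  qed
qed

context
  fixes P :: int
  assumes oddP: "odd P"
begin

lemma even_gen_fib_iff: "even (gen_fib P n) \<longleftrightarrow> 3 dvd n"
proof (rule prime_dvd_gen_fib_iff)
  fix i :: nat assume "0 < i" "i < 3"
  then have "i = 1 \<or> i = 2" by auto
  then show "odd (gen_fib P i)" using oddP by (auto simp: numeral_2_eq_2)
qed (use oddP in \<open>auto simp: numeral_3_eq_3\<close>)

lemma even_gen_lucas_iff: "even (gen_lucas P n) \<longleftrightarrow> 3 dvd n"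
  using oddP even_gen_fib_iff unfolding gen_lucas_eq by simp

text \<open>The shift formula with $k = 3$ reads $V_{n+6} = V_3 V_{n+3} + V_n$, and the same for $U$. As
  $V_3 = P(P^2+3) \equiv 4$ modulo 8 and the terms at multiples of 3 are even, the residue modulo 8
  repeats with period 6 along these indices.\<close>

lemma gen_lucas_mod_8:
  assumes "3 dvd n"
  shows "gen_lucas P n mod 8 = (if even n then 2 else 4)"
    and "odd n \<Longrightarrow> gen_fib P n mod 8 = 2"
proof -
  obtain P' where P: "P = 2 * P' + 1" using oddP oddE by blast
  have V3: "gen_lucas P 3 mod 8 = 4"
  proof -
    have "gen_lucas P 3 = P * (P\<^sup>2 + 3)" by (simp add: numeral_3_eq_3 power2_eq_square algebra_simps)
    moreover obtain c where "P\<^sup>2 = 8 * c + 1"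
      using odd_square_mod_8[OF oddP] by (metis mult_div_mod_eq)
    ultimately have "gen_lucas P 3 = 8 * (c * P + P') + 4" unfolding P by (simp add: algebra_simps)
    then show ?thesis by presburger
  qed
  have U3: "gen_fib P 3 mod 8 = 2"
    using odd_square_mod_8[OF oddP] by (simp add: numeral_3_eq_3 power2_eq_square) presburger
  have step: "(gen_lucas P 3 * x + y) mod 8 = y mod 8" if "even x" for x y
  proof -
    obtain z where "x = 2 * z" using \<open>even x\<close> by blast
    moreover obtain v where "gen_lucas P 3 = 8 * v + 4" using V3 by (metis mult_div_mod_eq)
    ultimately have "gen_lucas P 3 * x + y = y + 8 * (2 * v * z + z)" by (simp add: algebra_simps)
    then show ?thesis by (simp only: mod_mult_self2)
  qed
  have V: "gen_lucas P (n + 6) mod 8 = gen_lucas P n mod 8" if "3 dvd n" for n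
    using gen_lucas_double_shift[of P n 3] step[of "gen_lucas P (n + 3)" "gen_lucas P n"]
      even_gen_lucas_iff that by simp
  have U: "gen_fib P (n + 6) mod 8 = gen_fib P n mod 8" if "3 dvd n" for n
    using gen_fib_double_shift[of P n 3] step[of "gen_fib P (n + 3)" "gen_fib P n"]
      even_gen_fib_iff that by simp
  have E: "gen_lucas P (6 * i) mod 8 = 2" for i
  proof (induction i)
    case (Suc i)
    then show ?case using V[of "6 * i"] by (simp add: add.commute)
  qed simp
  have O: "gen_lucas P (6 * i + 3) mod 8 = 4 \<and> gen_fib P (6 * i + 3) mod 8 = 2" for i
  proof (induction i)
    case (Suc i)
    have eq: "6 * Suc i + 3 = (6 * i + 3) + 6" by simp
    have "3 dvd 6 * i + 3" by presburger
    then show ?case unfolding eq using Suc V U by metis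
  qed (use V3 U3 in simp)
  show "gen_lucas P n mod 8 = (if even n then 2 else 4)"
  proof (cases "even n")
    case True
    then have "n = 6 * (n div 6)" using assms by presburger
    then show ?thesis using E[of "n div 6"] True by simp
  next
    case False
    then have "n = 6 * (n div 6) + 3" using assms by presburger
    then show ?thesis using O[of "n div 6"] False by metis
  qed
  show "gen_fib P n mod 8 = 2" if "odd n"
  proof -
    have "n = 6 * (n div 6) + 3" using that assms by presburger
    then show ?thesis using O[of "n div 6"] by metis
  qed
qed

text \<open>These are the moduli to which the lemma on sums of two squares is applied.\<close>

lemma gen_lucas_power_of_2_mod_4:
  assumes "u > 0"
  shows "gen_lucas P (2 ^ u) mod 4 = 3"
  using assms
proof (induction u rule: nat_induct_non_zero)
  case 1
  show ?case using square_mod_4[of P] oddP by (simp add: numeral_2_eq_2 power2_eq_square) presburger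
next
  case (Suc u)
  have "gen_lucas P (2 ^ Suc u) = (gen_lucas P (2 ^ u))\<^sup>2 - 2"
    using gen_lucas_double[of P "2 ^ u"] Suc.hyps by simp
  moreover have "odd (gen_lucas P (2 ^ u))" using Suc.IH by presburger
  ultimately show ?case using square_mod_4[of "gen_lucas P (2 ^ u)"] by presburger
qed

end

lemma coprime_gen_fib_gen_lucas:
  assumes "odd P" "\<not> 3 dvd n"
  shows "coprime (gen_fib P n) (gen_lucas P n)"
proof (rule coprimeI)
  fix c assume c: "c dvd gen_fib P n" "c dvd gen_lucas P n"
  have "odd c" using c(1) even_gen_fib_iff[OF assms(1)] assms(2) dvd_trans by blast
  then show "is_unit c"
    using common_divisor_gen_fib_gen_lucas[OF c] by (metis coprime_common_divisor coprime_right_2_iff_odd dvd_refl)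
qed

text \<open>If 3 divides $n$, both terms are even; taking their powers of two out makes them coprime.\<close>

lemma coprime_gen_fib_gen_lucas_halves:
  assumes "gen_fib P n = a * u" "gen_lucas P n = b * v" "odd v"
  shows "coprime u v"
proof (rule coprimeI)
  fix c assume c: "c dvd u" "c dvd v"
  then have "c dvd 2" using common_divisor_gen_fib_gen_lucas[of c P n] assms by simp
  moreover have "odd c" using c(2) assms(3) dvd_trans by blast
  ultimately show "is_unit c" by (metis coprime_common_divisor coprime_right_2_iff_odd dvd_refl)
qed

section \<open>Reflection of odd indices\<close>

lemma odd_times_power_of_2:
  fixes n :: nat
  assumes "n > 0"
  obtains u g where "odd g" "n = 2 ^ u * g"
proof -
  obtain g where "n = 2 ^ multiplicity 2 n * g" "\<not> 2 dvd g"
    using multiplicity_decompose'[of n 2] assms by auto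
  then show ?thesis using that by blast
qed

text \<open>An odd $n \neq r$ satisfies $n \equiv r$ or $n \equiv -r$ modulo 4. In the first case the indices
  differ by $2 \cdot 2^u g$ with $u > 0$ and $g$ odd, and the sign change applies. In the second case
  $n$ and $-r$ differ in this way, and $U_{-r} = U_r$ for odd $r$. When a multiple of $U_n + U_r$ is
  a sum of two squares, the divisor contradicts its residue 3 modulo 4, and this rules out every odd
  index other than $r$.\<close>

lemma gen_lucas_dvd_sum_odd_indices:
  assumes "odd P" "odd r" "odd n" "n \<noteq> r"
  shows "\<exists>u>0. gen_lucas P (2 ^ u) dvd gen_fib P n + gen_fib P r"
proof -
  have *: "\<exists>u>0. gen_lucas P (2 ^ u) dvd s (i + d) + s i"
    if rec: "\<And>n. s (n + 2) = P * s (n + 1) + s n" and d: "4 dvd d" "d > 0" for s :: "nat \<Rightarrow> int" and i d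
  proof -
    obtain q where q: "d = 4 * q" using d(1) by blast
    then have "q > 0" using d(2) by simp
    then obtain u g where g: "odd g" "q = 2 ^ u * g" by (rule odd_times_power_of_2)
    have "gen_lucas P (2 ^ Suc u) dvd s (i + 2 * 2 ^ Suc u * g) + s i"
      by (rule gen_lucas_dvd_odd_shift[OF rec]) (use g in auto)
    moreover have "2 * 2 ^ Suc u * g = d" using q g by simp
    ultimately show ?thesis by (intro exI[of _ "Suc u"]) simp
  qed
  have up: "\<exists>u>0. gen_lucas P (2 ^ u) dvd gen_fib P n + gen_fib P r"
    if "r < n" "4 dvd n - r" for r n
    using *[of "gen_fib P" "n - r" r] that by (simp add: add.commute)
  have "(n > r \<and> 4 dvd n - r) \<or> (r > n \<and> 4 dvd r - n) \<or> 4 dvd n + r"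
    using assms(2-4) by presburger
  then consider "n > r" "4 dvd n - r" | "r > n" "4 dvd r - n" | "4 dvd n + r" by blast
  then show ?thesis
  proof cases
    case 1
    then show ?thesis by (rule up)
  next
    case 2
    then show ?thesis using up[of n r] by (simp add: add.commute)
  next
    case 3
    \<comment> \<open>The sequence continued to negative indices and shifted: $s(i) = U_{i-r}$.\<close>
    define s where "s i = (if i \<le> r then (-1) ^ i * gen_fib P (r - i) else gen_fib P (i - r))" for i
    have "s (i + 2) = P * s (i + 1) + s i" for i
    proof -
      consider j where "r = i + 2 + j" | "r = Suc i" | j where "i = r + j"
        by (metis add_2_eq_Suc' le_Suc_ex not_less_eq_eq Suc_leI add_Suc le_antisym)
      then show ?thesis
      proof cases
        case 1
        then show ?thesis by (simp add: s_def Suc_diff_le algebra_simps)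
      next
        case 2
        then show ?thesis using assms(2) by (simp add: s_def)
      next
        case 3
        then show ?thesis by (cases j) (simp_all add: s_def Suc_diff_le)
      qed
    qed
    then have "\<exists>u>0. gen_lucas P (2 ^ u) dvd s (0 + (n + r)) + s 0"
      by (rule *) (use 3 assms(2) in \<open>auto intro: odd_pos\<close>)
    moreover have "s (n + r) = gen_fib P n" using assms(3) by (cases n) (simp_all add: s_def)
    moreover have "s 0 = gen_fib P r" by (simp add: s_def)
    ultimately show ?thesis by simp
  qed
qed

section \<open>The quartic equation behind the fifth multiple\<close>

text \<open>Descent along the unit $(3 - \sqrt 5)/2$: multiplying $(A + B\sqrt 5)/2$ by it gives a smaller solution,
  and the inverse step raises the index of the Fibonacci and Lucas numbers by 2.\<close>

lemma pell_minus_4_fibonacci: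
  fixes A B :: int
  assumes "A\<^sup>2 = 5 * B\<^sup>2 - 4" "A \<ge> 0" "B > 0"
  shows "\<exists>n. odd n \<and> B = gen_fib 1 n \<and> A = gen_lucas 1 n"
  using assms
proof (induction "nat B" arbitrary: A B rule: less_induct)
  case less
  show ?case
  proof (cases "B = 1")
    case True
    then have "A\<^sup>2 = 1\<^sup>2" using less.prems by simp
    then have "A = 1" using less.prems(2) by (simp add: power2_eq_1_iff)
    then show ?thesis using True by (intro exI[of _ 1]) simp
  next
    case False
    then have B2: "B \<ge> 2" using less.prems(3) by simp
    have B4: "B\<^sup>2 \<ge> 4" using power_mono[OF B2, of 2] by simp
    have "even (A\<^sup>2) \<longleftrightarrow> even (B\<^sup>2)" using less.prems(1) by simp
    \<comment> \<open>The parity of $A + B$ is what makes the smaller solution $(A', B')$ integral.\<close>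
    then have "even (A + B)" by simp
    then have "even (3 * B - A)" "even (3 * A - 5 * B)" by auto
    then obtain B' A' where B': "3 * B - A = 2 * B'" and A': "3 * A - 5 * B = 2 * A'" by (elim evenE)
    \<comment> \<open>The three bounds say $B' > 0$, $B' < B$ and $A' \<ge> 0$.\<close>
    have A_lt: "A < 3 * B"
      by (rule power2_less_imp_less) (use less.prems B4 in \<open>auto simp: power_mult_distrib\<close>)
    have A_gt: "B < A"
      by (rule power2_less_imp_less) (use less.prems B4 in auto)
    have A_ge: "5 * B \<le> 3 * A"
      by (rule power2_le_imp_le) (use less.prems B4 in \<open>auto simp: power_mult_distrib\<close>)
    have "(2 * A')\<^sup>2 = 5 * (2 * B')\<^sup>2 - 16"
      unfolding A'[symmetric] B'[symmetric] using less.prems(1)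
      by (simp add: power2_eq_square algebra_simps)
    then have eq: "A'\<^sup>2 = 5 * B'\<^sup>2 - 4" by (simp add: power_mult_distrib)
    have "nat B' < nat B" "A' \<ge> 0" "B' > 0" using A_lt A_gt A_ge A' B' less.prems(3) by auto
    from less.hyps[OF this(1) eq this(2,3)]
    obtain n where n: "odd n" "B' = gen_fib 1 n" "A' = gen_lucas 1 n" by blast
    have "2 * B = 3 * B' + A'" "2 * A = 5 * B' + 3 * A'" using A' B' by auto
    then have "2 * B = 2 * gen_fib 1 (n + 2)" "2 * A = 2 * gen_lucas 1 (n + 2)"
      unfolding n gen_lucas_eq by auto
    then show ?thesis using n(1) by (intro exI[of _ "n + 2"]) simp
  qed
qed

text \<open>Completing the square makes $(4b, 2(2v^2+3)/5)$ a solution of $A^2 - 5B^2 = -4$, so that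
  $5 F_n - 6 = (2v)^2$ for an odd $n$. For $n \neq 3$ reflection against $F_3 = 2$ gives a Lucas
  number $L_{2^u}$, congruent to 3 modulo 4, that divides $5(F_n + 2) = (2v)^2 + 4^2$, which is
  impossible. The index $n = 3$ gives $v = 1$.\<close>

lemma quartic_5_square:
  fixes v b :: int
  assumes "v > 0" "v ^ 4 + 3 * v\<^sup>2 + 1 = 5 * b\<^sup>2"
  shows "v = 1"
proof -
  have sq: "(2 * v\<^sup>2 + 3)\<^sup>2 = 5 * (4 * b\<^sup>2 + 1)"
    using assms(2) by (simp add: power2_eq_square power4_eq_xxxx algebra_simps)
  then have "5 dvd (2 * v\<^sup>2 + 3)\<^sup>2" by simp
  then have "5 dvd 2 * v\<^sup>2 + 3" using prime_dvd_power_int[of 5 "2 * v\<^sup>2 + 3" 2] by simp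
  then obtain z where z: "2 * v\<^sup>2 + 3 = 5 * z" by (rule dvdE)
  have "(5 * z)\<^sup>2 = 5 * (4 * b\<^sup>2 + 1)" using sq unfolding z .
  then have "5 * z\<^sup>2 = 4 * b\<^sup>2 + 1" by (simp add: power_mult_distrib)
  then have pell: "\<bar>4 * b\<bar>\<^sup>2 = 5 * (2 * z)\<^sup>2 - 4" by (simp add: power_mult_distrib)
  have "v\<^sup>2 > 0" using assms(1) by simp
  then have "2 * z > 0" using z by linarith
  from pell_minus_4_fibonacci[OF pell _ this]
  obtain n where n: "odd n" "2 * z = gen_fib 1 n" by auto
  show ?thesis
  proof (cases "n = 3")
    case True
    then have "v\<^sup>2 = 1" using n(2) z by (simp add: numeral_3_eq_3)
    then show ?thesis using assms(1) by (simp add: power2_eq_1_iff)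
  next
    case False
    then obtain u where u: "u > 0" "gen_lucas 1 (2 ^ u) dvd gen_fib 1 n + gen_fib 1 3"
      using gen_lucas_dvd_sum_odd_indices[of 1 3 n] n(1) by auto
    have "gen_fib 1 n + gen_fib 1 3 = 2 * z + 2" unfolding n by (simp add: numeral_3_eq_3)
    moreover have "(2 * v)\<^sup>2 + 4\<^sup>2 = 5 * (2 * z + 2)" using z by (simp add: power_mult_distrib)
    ultimately have "gen_lucas 1 (2 ^ u) dvd (2 * v)\<^sup>2 + 4\<^sup>2" using u(2) by (simp only: dvd_mult)
    then obtain p :: nat where p: "prime p" "p mod 4 = 3" "int p dvd 4"
      using sum_squares_dvd_3_mod_4 gen_lucas_pos[of 1] gen_lucas_power_of_2_mod_4[of 1 u] u(1)
      by (metis odd_one zero_less_one)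
    then have "p dvd 2 ^ 2" using int_dvd_int_iff[of p 4] by simp
    then have "p dvd 2" using p(1) prime_dvd_power by blast
    then have "p = 2" using p(1) primes_dvd_imp_eq two_is_prime_nat by blast
    then show ?thesis using p(2) by simp
  qed
qed

text \<open>With the minus sign the quartic splits as $(v^2-v-1)(v^2+v-1)$. The factors are coprime, so one of
  them is a square, but both lie strictly between the neighbours $(v-1)^2$ and $(v+1)^2$ of $v^2$
  and differ from $v^2$.\<close>

lemma no_quartic_5_square_minus:
  fixes v b :: int
  assumes "v \<ge> 3"
  shows "v ^ 4 - 3 * v\<^sup>2 + 1 \<noteq> 5 * b\<^sup>2"
proof
  assume eq: "v ^ 4 - 3 * v\<^sup>2 + 1 = 5 * b\<^sup>2"
  define c d where "c = v\<^sup>2 - v - 1" and "d = v\<^sup>2 + v - 1"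
  have vv: "v\<^sup>2 \<ge> 3 * v" using assms by (simp add: power2_eq_square)
  then have pos: "c > 0" "d > 0" using assms unfolding c_def d_def by linarith+
  have cd: "c * d = 5 * b\<^sup>2"
    unfolding eq[symmetric] c_def d_def by (simp add: power2_eq_square power4_eq_xxxx algebra_simps)
  have "coprime c d"
  proof (rule coprimeI)
    fix e assume e: "e dvd c" "e dvd d"
    have "odd c" unfolding c_def by simp
    then have "coprime e 2" using e(1) by (meson coprime_right_2_iff_odd dvd_trans)
    moreover have "e dvd 2 * v" using dvd_diff[OF e(2,1)] unfolding c_def d_def by simp
    ultimately have "e dvd v" by (simp add: coprime_dvd_mult_right_iff)
    then have "e dvd v * (v - 1)" by simp
    moreover have "1 = v * (v - 1) - c" unfolding c_def by (simp add: power2_eq_square algebra_simps)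
    ultimately show "is_unit e" using e(1) by (metis dvd_diff)
  qed
  then consider s where "c = s\<^sup>2" | s where "d = s\<^sup>2"
    using coprime_prime_times_square_factors[of 5 c d b] cd pos by fastforce
  then show False
  proof cases
    case 1
    have "s\<^sup>2 = v\<^sup>2"
      by (rule square_eq_of_between)
        (use assms 1 in \<open>auto simp: c_def power2_eq_square algebra_simps\<close>)
    then show False using 1 assms unfolding c_def by simp
  next
    case 2
    have "s\<^sup>2 = v\<^sup>2"
      by (rule square_eq_of_between)
        (use assms 2 in \<open>auto simp: d_def power2_eq_square algebra_simps\<close>)
    then show False using 2 assms unfolding d_def by simp
  qed
qed

section \<open>The case where P squared is 1 modulo 5\<close>

text \<open>The rank of apparition of 5 is 5, so $n = 5m$. The quotient $U_{5m}/U_m$ is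
  $V_m^4 \mp 3V_m^2 + 1$; because 5 divides $P^2+4$ it equals $5w$ with $w$ coprime to $U_m$. Hence
  $w$ is a square, and the two lemmas on quartics determine $V_m$.\<close>

lemma gen_fib_eq_5_square_unit_residue:
  fixes P x :: int
  assumes "P > 0" "[P\<^sup>2 = 1] (mod 5)" "n \<ge> 1" "gen_fib P n = 5 * x\<^sup>2"
  shows "n = 5 \<and> P = 1"
proof -
  have P5: "P\<^sup>2 mod 5 = 1" using assms(2) by (simp add: cong_def)
  have nP: "\<not> 5 dvd P"
  proof
    assume "5 dvd P"
    then have "5 dvd P\<^sup>2" by (simp add: power2_eq_square)
    then show False using P5 by simp
  qed
  have U: "gen_fib P 2 = P" "gen_fib P 3 = P\<^sup>2 + 1" "gen_fib P 4 = P * (P\<^sup>2 + 2)"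
    "gen_fib P 5 = (P\<^sup>2)\<^sup>2 + 3 * P\<^sup>2 + 1"
    by (simp_all add: eval_nat_numeral power2_eq_square algebra_simps)
  obtain d where d: "P\<^sup>2 = 5 * d + 1" using P5 by (metis mult_div_mod_eq)
  have "5 dvd gen_fib P n \<longleftrightarrow> 5 dvd n"
  proof (rule prime_dvd_gen_fib_iff)
    show "5 dvd gen_fib P 5"
    proof -
      have "gen_fib P 5 = 5 * (5 * d\<^sup>2 + 5 * d + 1)" unfolding U d
        by (simp add: power2_eq_square algebra_simps)
      then show ?thesis by simp
    qed
    fix i :: nat assume "0 < i" "i < 5"
    then consider "i = 1" | "i = 2" | "i = 3" | "i = 4" by linarith
    then show "\<not> 5 dvd gen_fib P i"
    proof cases
      case 4
      have "\<not> 5 dvd P\<^sup>2 + 2" unfolding d by presburger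
      then show ?thesis using nP prime_dvd_mult_iff[of 5 P "P\<^sup>2 + 2"] 4 U by simp
    next
      case 3
      have "\<not> 5 dvd P\<^sup>2 + 1" unfolding d by presburger
      then show ?thesis using 3 U by simp
    qed (use nP U in auto)
  qed auto
  then obtain m where m: "n = 5 * m" using assms(4) by auto
  then have "m > 0" using assms(3) by simp
  define u v e where "u = gen_fib P m" and "v = gen_lucas P m" and "e = ((-1) ^ m :: int)"
  have "u > 0" unfolding u_def using gen_fib_pos assms(1) \<open>m > 0\<close> by blast
  have e2: "e * e = 1" unfolding e_def by (simp flip: power_mult_distrib)
  define D where "D = d + 1"
  have v2: "v\<^sup>2 = 5 * D * u\<^sup>2 + 4 * e"
    using gen_lucas_square[of P m] unfolding u_def v_def e_def d D_def by simp
  define w where "w = 5 * (D * u\<^sup>2)\<^sup>2 + 5 * e * (D * u\<^sup>2) + 1"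
  have w: "v ^ 4 - 3 * e * v\<^sup>2 + 1 = 5 * w"
  proof -
    have "v ^ 4 - 3 * e * v\<^sup>2 + 1 = (v\<^sup>2)\<^sup>2 - 3 * e * v\<^sup>2 + 1" by simp
    also have "\<dots> = 5 * (5 * (D * u\<^sup>2)\<^sup>2 + 5 * e * (D * u\<^sup>2)) + (4 * (e * e) + 1)"
      unfolding v2 by (simp add: power2_eq_square algebra_simps)
    finally show ?thesis unfolding e2 w_def by simp
  qed
  have uw: "w * u = x\<^sup>2"
    using assms(4) gen_fib_quintuple[of P m] w unfolding m u_def v_def e_def by (simp add: mult.commute)
  have "coprime w u"
  proof (rule coprimeI)
    fix c assume c: "c dvd w" "c dvd u"
    have "1 = w - u * (u * (5 * D * (D * u\<^sup>2) + 5 * e * D))"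
      unfolding w_def by (simp add: power2_eq_square algebra_simps)
    then show "is_unit c" using c by (metis dvd_diff dvd_mult2)
  qed
  moreover have "w > 0"
  proof -
    have "w \<ge> 0" using uw \<open>u > 0\<close> by (metis zero_le_mult_iff zero_le_power2 not_le)
    moreover have "w = 1 + 5 * ((D * u\<^sup>2)\<^sup>2 + e * (D * u\<^sup>2))" unfolding w_def by (simp add: algebra_simps)
    then have "w mod 5 = 1" by presburger
    ultimately show ?thesis by (cases "w = 0") auto
  qed
  ultimately obtain b where b: "w = b\<^sup>2" using coprime_square_factor uw by blast
  show ?thesis
  proof (cases "even m")
    case True
    then have "v \<ge> 3" unfolding v_def using gen_lucas_ge_3 assms(1) \<open>m > 0\<close> by (metis dvd_imp_le)
    then show ?thesis using no_quartic_5_square_minus[of v b] w b True by (simp add: e_def)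
  next
    case False
    then have "v = 1"
      using quartic_5_square[of v b] gen_lucas_pos[of P m] assms(1) w b unfolding v_def e_def by simp
    then have "m = 1" using gen_lucas_ge_3[of P m] assms(1) \<open>m > 0\<close> unfolding v_def by (cases "m = 1") auto
    then show ?thesis using \<open>v = 1\<close> m unfolding v_def by simp
  qed
qed

section \<open>The case where P is a multiple of 5\<close>

text \<open>For $s^2 = 8k+1$ the equation becomes $8k(4k+1) = (5t^2)^2$ with coprime factors. Then
  $8k = s^2 - 1$ is itself a square, so it is 0.\<close>

lemma quartic_50:
  fixes s t :: int
  assumes "s ^ 4 = 50 * t ^ 4 + 1"
  shows "t = 0"
proof -
  have "odd (s ^ 4)" using assms by simp
  then have "odd s" by simp
  then obtain k where k: "s\<^sup>2 = 8 * k + 1" using odd_square_mod_8 by (metis mult_div_mod_eq)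
  have "s ^ 4 = (s\<^sup>2)\<^sup>2" by simp
  then have eq: "8 * k * (4 * k + 1) = (5 * t\<^sup>2)\<^sup>2"
    using assms unfolding k by (simp add: power2_eq_square power4_eq_xxxx algebra_simps)
  have cop: "coprime (8 * k) (4 * k + 1)"
  proof (rule coprimeI)
    fix c assume c: "c dvd 8 * k" "c dvd 4 * k + 1"
    have "odd c" using c(2) dvd_trans[of 2 c "4 * k + 1"] by auto
    moreover have "2 = 2 * (4 * k + 1) - 8 * k" by simp
    then have "c dvd 2" using c by (metis dvd_diff dvd_mult)
    ultimately show "is_unit c" by (metis coprime_common_divisor coprime_right_2_iff_odd dvd_refl)
  qed
  have "k \<ge> 0" using k zero_le_power2[of s] by presburger
  have "k = 0"
  proof (rule ccontr)
    assume "k \<noteq> 0"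
    then have "8 * k > 0" using \<open>k \<ge> 0\<close> by simp
    then obtain y where "8 * k = y\<^sup>2" using coprime_square_factor[OF cop eq] by blast
    then show False using consecutive_squares[of s y] k \<open>k \<noteq> 0\<close> by simp
  qed
  then show ?thesis using eq by simp
qed

text \<open>With $|b| = 2c+1$ the equation says $c(c+1) = 2(5e^2)^2$, so the two consecutive numbers are $q^2$ and
  $2p^2$ with $qp = 5e^2$. A second splitting gives $q = s^2$, $p = 5t^2$, or $q = 5s^2$, $p = t^2$.
  Since fourth powers are 0 or 1 modulo 5, only $s^4 = 50t^4 + 1$ survives, and it forces $t = 0$.\<close>

lemma quartic_200:
  fixes b e :: int
  assumes "b\<^sup>2 = 200 * e ^ 4 + 1"
  shows "e = 0"
proof (rule ccontr)
  assume e: "e \<noteq> 0"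
  have "odd (b\<^sup>2)" using assms by simp
  then have "odd \<bar>b\<bar>" by simp
  then obtain c where c: "\<bar>b\<bar> = 2 * c + 1" by (rule oddE)
  have "b\<^sup>2 = (2 * c + 1)\<^sup>2" unfolding c[symmetric] by simp
  then have cc: "c * (c + 1) = 2 * (5 * e\<^sup>2)\<^sup>2"
    using assms by (simp add: power2_eq_square power4_eq_xxxx algebra_simps)
  have "c \<ge> 0" using c by linarith
  moreover have "c \<noteq> 0" using cc e by auto
  ultimately have "c > 0" by simp
  have two_squares: "\<exists>q p. q > 0 \<and> p > 0 \<and> x = q\<^sup>2 \<and> y = 2 * p\<^sup>2 \<and> q * p = 5 * e\<^sup>2"
    if xy: "x = s\<^sup>2" "y = 2 * t\<^sup>2" "x * y = 2 * (5 * e\<^sup>2)\<^sup>2" for x y s t :: int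
  proof -
    have "(\<bar>s\<bar> * \<bar>t\<bar>)\<^sup>2 = (5 * e\<^sup>2)\<^sup>2" using xy by (simp add: power_mult_distrib)
    then have "\<bar>s\<bar> * \<bar>t\<bar> = 5 * e\<^sup>2" by (rule power2_eq_imp_eq) auto
    moreover have "s \<noteq> 0" "t \<noteq> 0" using xy e by auto
    ultimately show ?thesis using xy by (intro exI[of _ "\<bar>s\<bar>"] exI[of _ "\<bar>t\<bar>"]) auto
  qed
  have "coprime c (c + 1)" by simp
  then have "\<exists>q p. q > 0 \<and> p > 0 \<and> q * p = 5 * e\<^sup>2 \<and> coprime q p \<and> (q\<^sup>2 = 2 * p\<^sup>2 + 1 \<or> q\<^sup>2 = 2 * p\<^sup>2 - 1)"
  proof -
    consider s t where "c = s\<^sup>2" "c + 1 = 2 * t\<^sup>2" | s t where "c + 1 = s\<^sup>2" "c = 2 * t\<^sup>2"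
      using coprime_prime_times_square_factors[OF _ \<open>coprime c (c + 1)\<close> cc] \<open>c > 0\<close> by auto
    then obtain q p where qp: "q > 0" "p > 0" "q * p = 5 * e\<^sup>2"
      "c = q\<^sup>2 \<and> c + 1 = 2 * p\<^sup>2 \<or> c + 1 = q\<^sup>2 \<and> c = 2 * p\<^sup>2"
    proof cases
      case 1
      then show ?thesis using two_squares[OF 1 cc] that by blast
    next
      case 2
      then show ?thesis using two_squares[OF 2] cc that by (metis mult.commute)
    qed
    have "coprime (q\<^sup>2) (2 * p\<^sup>2)" using qp(4) \<open>coprime c (c + 1)\<close> by (metis coprime_commute)
    then have "coprime q p" by simp
    then show ?thesis using qp by (intro exI[of _ q] exI[of _ p]) auto
  qed
  then obtain q p where qp: "q > 0" "p > 0" "q * p = 5 * e\<^sup>2" "coprime q p"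
    "q\<^sup>2 = 2 * p\<^sup>2 + 1 \<or> q\<^sup>2 = 2 * p\<^sup>2 - 1" by blast
  then consider s t where "q = s\<^sup>2" "p = 5 * t\<^sup>2" | s t where "q = 5 * s\<^sup>2" "p = t\<^sup>2"
    using coprime_prime_times_square_factors[of 5 q p e] by fastforce
  then show False
  proof cases
    case 1
    then have "s ^ 4 = 50 * t ^ 4 + 1 \<or> s ^ 4 = 50 * t ^ 4 - 1" using qp(5)
      by (auto simp: power_mult_distrib)
    moreover have "s ^ 4 \<noteq> 50 * t ^ 4 - 1"
    proof
      assume "s ^ 4 = 50 * t ^ 4 - 1"
      then have "s ^ 4 mod 5 = 4" by presburger
      then show False using fourth_power_mod_5[of s] by simp
    qed
    ultimately have "t = 0" using quartic_50 by blast
    then show False using 1 qp(2) by simp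
  next
    case 2
    then have "25 * s ^ 4 = 2 * t ^ 4 + 1 \<or> 25 * s ^ 4 = 2 * t ^ 4 - 1" using qp(5)
      by (auto simp: power_mult_distrib)
    then have "t ^ 4 mod 5 = 2 \<or> t ^ 4 mod 5 = 3" by presburger
    then show False using fourth_power_mod_5[of t] by auto
  qed
qed

text \<open>The rank of apparition of 5 is 2, so $n = 2m$ and $U_m V_m = 5x^2$. For odd $m$ a factor 3 of $m$ is
  excluded modulo 16; otherwise $U_m$ is a square, and reflection against $U_1 = 1$ leaves $m = 1$.
  For even $m = 2j$ the number $V_m = V_j^2 \mp 2$ is not a square, whence $V_m = 2t^2$ and
  $U_m = 10s^2$. If $j$ is even this descends to $U_j = 5a^2$; if $j$ is odd, then $V_j = 20e^2$ and
  $t^2 = 200e^4 + 1$.\<close>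

lemma gen_fib_eq_5_square_multiple_5:
  fixes P x :: int
  assumes "P > 0" "odd P" "5 dvd P" "n \<ge> 1" "gen_fib P n = 5 * x\<^sup>2"
  shows "n = 2"
  using assms(4,5)
proof (induction n arbitrary: x rule: less_induct)
  case (less n)
  have five: "5 dvd gen_fib P k \<longleftrightarrow> even k" for k
  proof (rule prime_dvd_gen_fib_iff)
    show "5 dvd gen_fib P 2" using assms(3) by (simp add: numeral_2_eq_2)
    fix i :: nat assume "0 < i" "i < 2"
    then have "i = 1" by simp
    then show "\<not> 5 dvd gen_fib P i" by simp
  qed auto
  have five_lucas: "\<not> 5 dvd gen_lucas P k" if "even k" for k
    using common_divisor_gen_fib_gen_lucas[of 5 P k] five[of k] that by auto
  note pos = gen_fib_pos[OF assms(1)] gen_lucas_pos[OF assms(1)]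
  have "even n" using five[of n] less.prems by simp
  then obtain m where n: "n = 2 * m" by (rule evenE)
  have "m > 0" using n less.prems(1) by simp
  have UV: "gen_fib P m * gen_lucas P m = 5 * x\<^sup>2"
    using less.prems(2) gen_fib_double[of P m] n by simp
  show ?case
  proof (cases "odd m")
    case True
    show ?thesis
    proof (cases "3 dvd m")
      case three: True
      obtain a b where "gen_fib P m = 8 * a + 2" "gen_lucas P m = 8 * b + 4"
        using gen_lucas_mod_8[OF assms(2) three] True by (metis mult_div_mod_eq)
      then have "gen_fib P m * gen_lucas P m = 8 + 16 * (4 * a * b + 2 * a + b)"
        by (simp add: algebra_simps)
      then have "5 * x\<^sup>2 mod 16 = 8 mod 16" unfolding UV by (simp only: mod_mult_self2)
      then have "5 * x\<^sup>2 mod 16 = 8" by simp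
      then show ?thesis using five_times_square_mod_16 by blast
    next
      case False
      obtain s where s: "gen_fib P m = s\<^sup>2"
        using coprime_prime_times_square_factors[OF _ coprime_gen_fib_gen_lucas[OF assms(2) False] UV]
          pos \<open>m > 0\<close> five[of m] True by auto
      have "m = 1"
      proof (rule ccontr)
        assume "m \<noteq> 1"
        then obtain u where u: "u > 0" "gen_lucas P (2 ^ u) dvd gen_fib P m + gen_fib P 1"
          using gen_lucas_dvd_sum_odd_indices[OF assms(2), of 1 m] True by auto
        then have "gen_lucas P (2 ^ u) dvd s\<^sup>2 + 1\<^sup>2" unfolding s by simp
        then obtain p :: nat where "prime p" "int p dvd 1"
          using sum_squares_dvd_3_mod_4 pos(2) gen_lucas_power_of_2_mod_4[OF assms(2) u(1)] by metis
        then show False by simp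
      qed
      then show ?thesis using n by simp
    qed
  next
    case False
    then obtain j where m: "m = 2 * j" by auto
    have "j > 0" using m \<open>m > 0\<close> by simp
    have Vm: "gen_lucas P m = (gen_lucas P j)\<^sup>2 - 2 * (-1) ^ j" unfolding m by (rule gen_lucas_double)
    show ?thesis
    proof (cases "3 dvd m")
      case no3: False
      obtain t where "gen_lucas P m = t\<^sup>2"
        using coprime_prime_times_square_factors[OF _ coprime_gen_fib_gen_lucas[OF assms(2) no3] UV]
          pos \<open>m > 0\<close> five_lucas[of m] False by auto
      then have "t\<^sup>2 = (gen_lucas P j)\<^sup>2 - 2 * (-1) ^ j" using Vm by simp
      then show ?thesis using square_mod_4[of t] square_mod_4[of "gen_lucas P j"]
        by (cases "even j") (auto split: if_splits, presburger+)
    next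
      case True
      then have "3 dvd j" using m by presburger
      have even_half: "\<exists>v. gen_lucas P i = 2 * v \<and> odd v" if i: "3 dvd i" "even i" for i
      proof -
        obtain c where "gen_lucas P i = 8 * c + 2"
          using gen_lucas_mod_8(1)[OF assms(2) i(1)] i(2) by (metis mult_div_mod_eq)
        then show ?thesis by (intro exI[of _ "4 * c + 1"]) simp
      qed
      obtain v where v: "gen_lucas P m = 2 * v" "odd v" using even_half[OF True] False by blast
      obtain u where u: "gen_fib P m = 2 * u"
        using even_gen_fib_iff[OF assms(2)] True by blast
      have "even (5 * x\<^sup>2)" unfolding UV[symmetric] u by simp
      then obtain y where "x = 2 * y" by auto
      then have uv: "u * v = 5 * y\<^sup>2" using UV unfolding u v by (simp add: power_mult_distrib)
      have "u > 0" "v > 0" using pos(1)[OF \<open>m > 0\<close>] pos(2)[of m] unfolding u v by simp_all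
      moreover have "coprime u v" by (rule coprime_gen_fib_gen_lucas_halves[OF u v])
      moreover have "\<not> 5 dvd v" using five_lucas[of m] False v(1) by auto
      ultimately obtain s t where st: "u = 5 * s\<^sup>2" "v = t\<^sup>2"
        using coprime_prime_times_square_factors[OF _ _ uv] by auto
      have Uj: "gen_fib P j * gen_lucas P j = 10 * s\<^sup>2"
        using u st gen_fib_double[of P j] unfolding m by simp
      show ?thesis
      proof (cases "even j")
        case True
        obtain w where w: "gen_lucas P j = 2 * w" "odd w" using even_half[OF \<open>3 dvd j\<close> True] by blast
        have "coprime (gen_fib P j) w"
          by (rule coprime_gen_fib_gen_lucas_halves[where a = 1, OF _ w]) simp
        moreover have "gen_fib P j * w = 5 * s\<^sup>2" using Uj unfolding w by (simp add: mult.commute)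
        moreover have "w > 0" using pos(2)[of j] unfolding w by simp
        moreover have "\<not> 5 dvd w" using five_lucas[OF True] w(1) by auto
        ultimately obtain a where "gen_fib P j = 5 * a\<^sup>2"
          using coprime_prime_times_square_factors[of 5 "gen_fib P j" w s] pos(1)[OF \<open>j > 0\<close>] by auto
        \<comment> \<open>The induction hypothesis contradicts that 3 divides $j$.\<close>
        then have "j = 2" using less.IH[of j] \<open>j > 0\<close> m n by simp
        then show ?thesis using \<open>3 dvd j\<close> by simp
      next
        case False
        obtain a where a: "gen_fib P j = 2 * a"
          using even_gen_fib_iff[OF assms(2)] \<open>3 dvd j\<close> by blast
        obtain d where "gen_lucas P j = 8 * d + 4"
          using gen_lucas_mod_8(1)[OF assms(2) \<open>3 dvd j\<close>] False by (metis mult_div_mod_eq)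
        then obtain b where b: "gen_lucas P j = 4 * b" "odd b"
          using that[of "2 * d + 1"] by simp
        have ab: "4 * (a * b) = 5 * s\<^sup>2" using Uj unfolding a b by simp
        then have "even (5 * s\<^sup>2)" by (metis even_mult_iff even_numeral)
        then obtain c where "s = 2 * c" by auto
        then have ab': "a * b = 5 * c\<^sup>2" using ab by (simp add: power_mult_distrib)
        have "a > 0" "b > 0" using pos(1)[OF \<open>j > 0\<close>] pos(2)[of j] unfolding a b by simp_all
        moreover have "coprime a b" by (rule coprime_gen_fib_gen_lucas_halves[OF a b])
        moreover have "\<not> 5 dvd a" using five[of j] False a by auto
        ultimately obtain e where e: "b = 5 * e\<^sup>2"
          using coprime_prime_times_square_factors[OF _ _ ab'] by auto
        have "2 * t\<^sup>2 = (20 * e\<^sup>2)\<^sup>2 + 2" using Vm v st False unfolding b e by simp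
        then have "t\<^sup>2 = 200 * e ^ 4 + 1" by (simp add: power_mult_distrib)
        then have "e = 0" by (rule quartic_200)
        then show ?thesis using e \<open>b > 0\<close> by simp
      qed
    qed
  qed
qed

section \<open>The case where P squared is -1 modulo 5\<close>

lemma coprime_even_neighbours:
  fixes a :: int
  assumes "odd a"
  shows "coprime a (a + 2)"
proof -
  have "coprime a 2" using assms by simp
  then show ?thesis by (simp add: coprime_iff_gcd_eq_1 gcd_add2)
qed

text \<open>Divided by 8, the product has the coprime factors $(v^2+1)/2$ and $(v^2+3)/4$, so the latter is $r^2$
  or $5r^2$. But $(2r)^2 = v^2 + 3$ would put a square between $v^2$ and $(v+1)^2$, and
  $v^2 = 20r^2 - 3$ would be 2 modulo 5, which no square is.\<close>

lemma square_plus_1_times_square_plus_3_ne: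
  fixes v w :: int
  assumes "odd v" "v \<ge> 2" "c = 1 \<or> c = 5"
  shows "(v\<^sup>2 + 1) * (v\<^sup>2 + 3) \<noteq> 2 * c * w\<^sup>2"
proof
  assume prod: "(v\<^sup>2 + 1) * (v\<^sup>2 + 3) = 2 * c * w\<^sup>2"
  obtain k where k: "v\<^sup>2 = 8 * k + 1" using odd_square_mod_8[OF assms(1)] by (metis mult_div_mod_eq)
  then have "k \<ge> 0" using zero_le_power2[of v] by presburger
  have cw: "4 * ((4 * k + 1) * (2 * k + 1)) = c * w\<^sup>2"
    using prod unfolding k by (simp add: algebra_simps)
  then have "even (c * w\<^sup>2)" by (metis even_mult_iff even_numeral)
  then obtain x where "w = 2 * x" using assms(3) by auto
  then have eq: "(2 * k + 1) * (4 * k + 1) = c * x\<^sup>2" using cw by (simp add: power_mult_distrib algebra_simps)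
  have cop: "coprime (2 * k + 1) (4 * k + 1)"
  proof (rule coprimeI)
    fix d assume "d dvd 2 * k + 1" "d dvd 4 * k + 1"
    moreover have "1 = 2 * (2 * k + 1) - (4 * k + 1)" by simp
    ultimately show "is_unit d" by (metis dvd_diff dvd_mult)
  qed
  have "\<exists>r. 2 * k + 1 = r\<^sup>2 \<or> 2 * k + 1 = 5 * r\<^sup>2"
  proof (cases "c = 1")
    case True
    then show ?thesis using coprime_square_factor[OF cop, of x] eq \<open>k \<ge> 0\<close> by auto
  next
    case False
    then have "(2 * k + 1) * (4 * k + 1) = 5 * x\<^sup>2" using eq assms(3) by simp
    from coprime_prime_times_square_factors[OF _ cop this] show ?thesis using \<open>k \<ge> 0\<close> by auto
  qed
  then obtain r where "2 * k + 1 = r\<^sup>2 \<or> 2 * k + 1 = 5 * r\<^sup>2" by blast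
  then show False
  proof
    assume "2 * k + 1 = r\<^sup>2"
    then have r: "(2 * r)\<^sup>2 = v\<^sup>2 + 3" using k by (simp add: power_mult_distrib)
    have "(2 * r)\<^sup>2 = v\<^sup>2"
      by (rule square_eq_of_between) (use assms(2) in \<open>auto simp only: r, auto simp: power2_eq_square algebra_simps\<close>)
    then show False using r by simp
  next
    assume "2 * k + 1 = 5 * r\<^sup>2"
    then have "v\<^sup>2 = 20 * r\<^sup>2 - 3" using k by simp
    then have "v\<^sup>2 mod 5 = 2" by presburger
    then show False using square_mod_5[of v] by simp
  qed
qed

lemma three_square_split:
  fixes a x :: int
  assumes "odd a" "a > 0" "a * (a + 2) = 3 * x\<^sup>2"
  shows "(\<exists>s t. a = s\<^sup>2 \<and> a + 2 = 3 * t\<^sup>2) \<or> (\<exists>s t. a = 3 * s\<^sup>2 \<and> a + 2 = t\<^sup>2)"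
  using coprime_prime_times_square_factors[OF _ coprime_even_neighbours[OF assms(1)] assms(3)] assms(2) by simp

text \<open>Put $V = V_{2l}$ and $v = V_l \ge 3$, so that $V = v^2 \mp 2$. Modulo 8 only $c = 3$ is possible. The
  factors $V - 1$ and $V + 1$ are then coprime, and one of them is a square. Both differ from $v^2$ by
  1 or 3, which is too little for a square.\<close>

lemma gen_lucas_double_square_minus_1_even:
  assumes "P > 0" "odd P" "l > 0" "3 dvd l" "c \<in> {1,3,5,15}"
  shows "(gen_lucas P (2 * l))\<^sup>2 - 1 \<noteq> c * b\<^sup>2"
proof
  define V where "V = gen_lucas P (2 * l)"
  define v where "v = gen_lucas P l"
  assume "(gen_lucas P (2 * l))\<^sup>2 - 1 = c * b\<^sup>2"
  then have eq: "V\<^sup>2 - 1 = c * b\<^sup>2" by (simp add: V_def)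
  have "V mod 8 = 2" using gen_lucas_mod_8(1)[OF assms(2), of "2 * l"] assms(4) by (simp add: V_def)
  then obtain k where k: "V = 8 * k + 2" by (metis mult_div_mod_eq)
  have "c * b\<^sup>2 = 8 * (8 * k * k + 4 * k) + 3" unfolding eq[symmetric] k
    by (simp add: power2_eq_square algebra_simps)
  then have "c * b\<^sup>2 mod 8 = 3" by presburger
  then have "c * (b\<^sup>2 mod 8) mod 8 = 3" by (simp add: mod_mult_right_eq)
  then have "c = 3" using assms(5) square_mod_8[of b] by auto
  have "l \<ge> 2" using assms(3,4) by presburger
  then have v3: "v \<ge> 3" unfolding v_def using gen_lucas_ge_3 assms(1) by blast
  have V: "V = v\<^sup>2 - 2 * (-1) ^ l" unfolding V_def v_def by (rule gen_lucas_double)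
  have "(V - 1) * (V - 1 + 2) = 3 * b\<^sup>2" using eq \<open>c = 3\<close> by (simp add: power2_eq_square algebra_simps)
  moreover have "odd (V - 1)" using k by simp
  moreover have "V - 1 > 0" using gen_lucas_ge_3[of P "2 * l"] assms(1,3) unfolding V_def by simp
  ultimately have "(\<exists>s t. V - 1 = s\<^sup>2 \<and> V - 1 + 2 = 3 * t\<^sup>2) \<or> (\<exists>s t. V - 1 = 3 * s\<^sup>2 \<and> V - 1 + 2 = t\<^sup>2)"
    using three_square_split by blast
  then consider s where "V - 1 = s\<^sup>2" | s t where "V - 1 = 3 * s\<^sup>2" "V - 1 + 2 = t\<^sup>2" by blast
  then show False
  proof cases
    case 1
    then show False using square_plus_small[OF v3, of s "V - 1 - v\<^sup>2"] V by (cases "even l") auto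
  next
    case 2
    then show False using square_plus_small[OF v3, of t "V + 1 - v\<^sup>2"] V by (cases "even l") auto
  qed
qed

text \<open>Put $V = V_{2j} = 2p + 1$, so that $p(p+1)$ is $c$ times a square. Since $V_j$ is odd, $V = V_j^2 \mp 2$
  is 3 or 7 modulo 8. The residue 3 (odd $j$) would make $p(p+1)$ twice an odd number. For even
  $j = 2i$ one has $p \equiv 3$ modulo 4, so $p$ is neither a square nor five times one; the factor 3
  must sit in $p$, and $p + 1$ is a square or five times a square. Now $2p = V_j^2 - 3$ shows that
  3 divides $V_j = V_i^2 \mp 2$, which leaves $V_j = V_i^2 + 2$, and
  $2(p+1) = V_j^2 - 1 = (V_i^2+1)(V_i^2+3)$.\<close>

lemma gen_lucas_double_square_minus_1_odd:
  assumes "P > 0" "odd P" "P\<^sup>2 mod 5 = 4" "j > 0" "\<not> 3 dvd j" "c \<in> {1,3,5,15}"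
  shows "(gen_lucas P (2 * j))\<^sup>2 - 1 \<noteq> c * b\<^sup>2"
proof
  define V where "V = gen_lucas P (2 * j)"
  define v where "v = gen_lucas P j"
  assume "(gen_lucas P (2 * j))\<^sup>2 - 1 = c * b\<^sup>2"
  then have eq: "V\<^sup>2 - 1 = c * b\<^sup>2" by (simp add: V_def)
  have V: "V = v\<^sup>2 - 2 * (-1) ^ j" unfolding V_def v_def by (rule gen_lucas_double)
  have "odd v" unfolding v_def using even_gen_lucas_iff[OF assms(2)] assms(5) by simp
  then have v8: "v\<^sup>2 mod 8 = 1" by (rule odd_square_mod_8)
  have "odd (v\<^sup>2)" using \<open>odd v\<close> by simp
  then have "odd V" unfolding V by simp
  have "odd c" using assms(6) by auto
  \<comment> \<open>$V^2 - 1 = 4p(p+1)$ has consecutive, hence coprime, factors.\<close>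
  define p where "p = (V - 1) div 2"
  have Vp: "V = 2 * p + 1" unfolding p_def using \<open>odd V\<close> by presburger
  have "4 * (p * (p + 1)) = c * b\<^sup>2" unfolding eq[symmetric] Vp
    by (simp add: power2_eq_square algebra_simps)
  moreover from this have "even (c * b\<^sup>2)" by (metis even_mult_iff even_numeral)
  then obtain y where "b = 2 * y" using \<open>odd c\<close> by auto
  ultimately have p: "p * (p + 1) = c * y\<^sup>2" by (simp add: power_mult_distrib)
  have "V \<ge> 3" unfolding V_def using gen_lucas_ge_3 assms(1,4) by simp
  then have "p > 0" using Vp by simp
  have "even j"
  proof (rule ccontr)
    assume "odd j"
    then have "V mod 8 = 3" using V v8 by simp presburger
    then have "p mod 4 = 1" using Vp by presburger
    then obtain q where q: "p = 4 * q + 1" by (metis mult_div_mod_eq)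
    have cy: "c * y\<^sup>2 = 4 * (4 * q * q + 3 * q) + 2" unfolding p[symmetric] q by (simp add: algebra_simps)
    then have "even (c * y\<^sup>2)" by simp
    then obtain z where "y = 2 * z" using \<open>odd c\<close> by auto
    then have "4 * (c * z\<^sup>2) = 4 * (4 * q * q + 3 * q) + 2" using cy by (simp add: power_mult_distrib)
    then show False by presburger
  qed
  then have "V mod 8 = 7" using V v8 by simp presburger
  then have p4: "p mod 4 = 3" using Vp by presburger
  have no_sq: "p \<noteq> s\<^sup>2" "p \<noteq> 5 * s\<^sup>2" for s
    using p4 square_mod_4[of s] by (auto split: if_splits, presburger+)
  have cop: "coprime p (p + 1)" by simp
  have key: "3 dvd p \<and> (\<exists>t. p + 1 = t\<^sup>2 \<or> p + 1 = 5 * t\<^sup>2)"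
  proof -
    consider "c = 1" | "c = 5" | "c = 3" | "c = 15" using assms(6) by auto
    then show ?thesis
    proof cases
      case 1
      then show ?thesis using coprime_square_factor[OF cop, of y] p no_sq \<open>p > 0\<close> by auto
    next
      case 2
      then show ?thesis using coprime_prime_times_square_factors[OF _ cop, of 5 y] p no_sq \<open>p > 0\<close> by auto
    next
      case 3
      then show ?thesis using coprime_prime_times_square_factors[OF _ cop, of 3 y] p no_sq \<open>p > 0\<close> by auto
    next
      case 4
      have split: "(\<exists>s t. q = s\<^sup>2 \<and> r = 5 * t\<^sup>2) \<or> (\<exists>s t. q = 5 * s\<^sup>2 \<and> r = t\<^sup>2)"
        if "coprime q r" "q * r = 5 * y\<^sup>2" "q > 0" "r > 0" for q r
        using coprime_prime_times_square_factors[of 5 q r y] that by simp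
      have "3 dvd p * (p + 1)" using p 4 by simp
      then consider "3 dvd p" | "3 dvd p + 1" using prime_dvd_mult_iff[of 3 p "p + 1"] by auto
      then show ?thesis
      proof cases
        case 1
        then obtain q where q: "p = 3 * q" by blast
        have "coprime q (p + 1)" using cop q by (metis coprime_mult_left_iff)
        moreover have "q * (p + 1) = 5 * y\<^sup>2" "q > 0" using p 4 \<open>p > 0\<close> q by auto
        ultimately show ?thesis using split[of q "p + 1"] 1 \<open>p > 0\<close> by auto
      next
        case 2
        then obtain q where q: "p + 1 = 3 * q" by blast
        have "coprime p q" using cop q by (metis coprime_mult_right_iff)
        moreover have "p * q = 5 * y\<^sup>2" "q > 0" using p 4 \<open>p > 0\<close> q by auto
        ultimately show ?thesis using split[of p q] no_sq \<open>p > 0\<close> by auto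
      qed
    qed
  qed
  then obtain t where "p + 1 = 1 * t\<^sup>2 \<or> p + 1 = 5 * t\<^sup>2" by auto
  then obtain c' where t: "p + 1 = c' * t\<^sup>2" "c' = 1 \<or> c' = 5" by blast
  have v2p: "v\<^sup>2 - 3 = 2 * p" using V Vp \<open>even j\<close> by simp
  then have "3 dvd v\<^sup>2 - 3" using key by simp
  then have "3 dvd v\<^sup>2" by (simp add: dvd_diff_left_iff)
  then have "3 dvd v" using prime_dvd_power_int[of 3 v 2] by simp
  obtain i where i: "j = 2 * i" using \<open>even j\<close> by (rule evenE)
  define w where "w = gen_lucas P i"
  have vw: "v = w\<^sup>2 - 2 * (-1) ^ i" unfolding v_def w_def i by (rule gen_lucas_double)
  have "odd i"
  proof
    assume "even i"
    then have "v + 3 = w\<^sup>2 + 1" using vw by simp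
    then show False using \<open>3 dvd v\<close> not_3_dvd_square_plus_1[of w] by (metis dvd_add dvd_refl)
  qed
  then have vw: "v = w\<^sup>2 + 2" using vw by simp
  have "v\<^sup>2 - 1 = 2 * c' * t\<^sup>2" using v2p t by simp
  then have prod: "(w\<^sup>2 + 1) * (w\<^sup>2 + 3) = 2 * c' * t\<^sup>2" unfolding vw by (simp add: power2_eq_square algebra_simps)
  have "odd w" using \<open>odd v\<close> vw by simp
  \<comment> \<open>$V_i = 1$ happens only for $i = P = 1$, against the residue of $P^2$.\<close>
  have "w \<noteq> 1"
  proof
    assume "w = 1"
    then have "i < 2" using gen_lucas_ge_3[of P i] assms(1) unfolding w_def by linarith
    then have "i = 1" using \<open>odd i\<close> by (cases i) auto
    then have "P = 1" using \<open>w = 1\<close> unfolding w_def by simp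
    then show False using assms(3) by simp
  qed
  then have "w \<ge> 2" using gen_lucas_pos[OF assms(1), of i] unfolding w_def by simp
  then show False using square_plus_1_times_square_plus_3_ne[OF \<open>odd w\<close> _ t(2)] prod by blast
qed

text \<open>The rank of apparition of 5 is 3, so $n = 3m$ and $U_m Q = 5x^2$ with
  $Q = V_m^2 - (-1)^m = (P^2+4)U_m^2 + 3(-1)^m$. A common divisor of $U_m$ and $Q$ divides 3. For odd
  $m$ it is 1, because 3 never divides $V_m^2 + 1$, and $V_m^2 + 1 = 5t^2$ fails modulo 8. For even
  $m$ the number $V_m^2 - 1$ is 1, 3, 5 or 15 times a square.\<close>

lemma gen_fib_ne_5_square_minus_unit_residue:
  fixes P x :: int
  assumes "P > 0" "odd P" "[P\<^sup>2 = -1] (mod 5)" "n \<ge> 1"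
  shows "gen_fib P n \<noteq> 5 * x\<^sup>2"
proof
  assume Un: "gen_fib P n = 5 * x\<^sup>2"
  have P5: "P\<^sup>2 mod 5 = 4" using assms(3) by (simp add: cong_def)
  have "5 dvd gen_fib P n \<longleftrightarrow> 3 dvd n"
  proof (rule prime_dvd_gen_fib_iff)
    have "gen_fib P 3 = P\<^sup>2 + 1" by (simp add: eval_nat_numeral power2_eq_square)
    then show "5 dvd gen_fib P 3" using P5 by presburger
    fix i :: nat assume "0 < i" "i < 3"
    then have "i = 1 \<or> i = 2" by auto
    moreover have "\<not> 5 dvd P"
    proof
      assume "5 dvd P"
      then have "5 dvd P\<^sup>2" by (simp add: power2_eq_square)
      then show False using P5 by simp
    qed
    ultimately show "\<not> 5 dvd gen_fib P i" by (auto simp: numeral_2_eq_2)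
  qed auto
  then obtain m where n: "n = 3 * m" using Un by auto
  then have "m > 0" using assms(4) by simp
  define U V e Q where "U = gen_fib P m" and "V = gen_lucas P m" and "e = ((-1) ^ m :: int)" and "Q = V\<^sup>2 - e"
  have "U > 0" unfolding U_def using gen_fib_pos assms(1) \<open>m > 0\<close> by blast
  have UQ: "U * Q = 5 * x\<^sup>2"
    using Un gen_fib_triple[of P m] unfolding n U_def V_def e_def Q_def by simp
  have Q: "Q = (P\<^sup>2 + 4) * U\<^sup>2 + 3 * e"
    using gen_lucas_square[of P m] unfolding U_def V_def e_def Q_def by simp
  have e: "e = 1 \<or> e = -1" unfolding e_def by (cases "even m") simp_all
  have "Q > 0"
  proof -
    have "U * Q = gen_fib P n" using UQ Un by simp
    also have "\<dots> > 0" using gen_fib_pos assms(1,4) by simp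
    finally show ?thesis using \<open>U > 0\<close> by (simp add: zero_less_mult_iff)
  qed
  have cop: "coprime U Q" if "\<not> 3 dvd U"
  proof (rule coprimeI)
    fix d assume d: "d dvd U" "d dvd Q"
    have "3 = e * (Q - U * ((P\<^sup>2 + 4) * U))" unfolding Q using e by (auto simp: power2_eq_square)
    then have "d dvd 3" using d by (metis dvd_diff dvd_mult dvd_mult2)
    moreover have "coprime 3 U" using that by (intro prime_imp_coprime) auto
    ultimately show "is_unit d" using d(1) coprime_common_divisor by blast
  qed
  show False
  proof (cases "even m")
    case False
    then have QV: "Q = V\<^sup>2 + 1" unfolding Q_def e_def by simp
    have "\<not> 3 dvd U"
    proof
      assume "3 dvd U"
      then have "3 dvd Q" unfolding Q using False by (simp add: power2_eq_square)
      then show False using not_3_dvd_square_plus_1[of V] QV by simp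
    qed
    then consider t where "Q = t\<^sup>2" | t where "Q = 5 * t\<^sup>2"
      using coprime_prime_times_square_factors[OF _ cop UQ] \<open>U > 0\<close> \<open>Q > 0\<close> by auto
    then show False
    proof cases
      case 1
      then have "V = 0" using consecutive_squares[of t V] QV by simp
      then show False using gen_lucas_pos[OF assms(1), of m] unfolding V_def by simp
    next
      case 2
      have "V\<^sup>2 mod 8 \<in> {0, 1}"
      proof (cases "3 dvd m")
        case True
        then have "V mod 8 = 4" using gen_lucas_mod_8(1)[OF assms(2) True] \<open>odd m\<close> by (simp add: V_def)
        then have "V\<^sup>2 mod 8 = 4\<^sup>2 mod 8" by (metis power_mod)
        then show ?thesis by simp
      next
        case False
        then have "odd V" using even_gen_lucas_iff[OF assms(2)] unfolding V_def by simp
        then show ?thesis using odd_square_mod_8 by simp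
      qed
      then have "(V\<^sup>2 + 1) mod 8 \<in> {1, 2}" by (subst mod_add_left_eq[symmetric]) auto
      moreover have "V\<^sup>2 + 1 = 5 * t\<^sup>2" using 2 QV by simp
      ultimately show False using five_times_square_mod_8[of t] by auto
    qed
  next
    case True
    then have QV: "Q = V\<^sup>2 - 1" and "e = 1" unfolding Q_def e_def by simp_all
    have "\<exists>c\<in>{1,3,5,15}. \<exists>b. Q = c * b\<^sup>2"
    proof (cases "3 dvd U")
      case False
      then show ?thesis
        using coprime_prime_times_square_factors[OF _ cop UQ] \<open>U > 0\<close> \<open>Q > 0\<close> by auto
    next
      case three: True
      then obtain u where u: "U = 3 * u" by blast
      define q where "q = 3 * (P\<^sup>2 + 4) * u\<^sup>2 + 1"
      have q: "Q = 3 * q" unfolding Q q_def u \<open>e = 1\<close> by (simp add: power_mult_distrib)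
      have "9 * (u * q) = 5 * x\<^sup>2" using UQ unfolding u q by simp
      then have "3 dvd 5 * x\<^sup>2" by presburger
      then have "3 dvd x\<^sup>2" by presburger
      then have "3 dvd x" using prime_dvd_power_int[of 3 x 2] by simp
      then obtain y where "x = 3 * y" by blast
      then have uq: "u * q = 5 * y\<^sup>2" using \<open>9 * (u * q) = 5 * x\<^sup>2\<close> by (simp add: power_mult_distrib mult.commute)
      have "coprime u q"
      proof (rule coprimeI)
        fix d assume d: "d dvd u" "d dvd q"
        have "1 = q - u * (3 * (P\<^sup>2 + 4) * u)" unfolding q_def by (simp add: power2_eq_square)
        then show "is_unit d" using d by (metis dvd_diff dvd_mult2)
      qed
      then show ?thesis
        using coprime_prime_times_square_factors[OF _ _ uq] \<open>U > 0\<close> \<open>Q > 0\<close> u q by fastforce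
    qed
    then obtain c b where c: "c \<in> {1,3,5,15}" "V\<^sup>2 - 1 = c * b\<^sup>2" unfolding QV by blast
    obtain j where m: "m = 2 * j" using True by (rule evenE)
    have "j > 0" using m \<open>m > 0\<close> by simp
    show False
    proof (cases "3 dvd j")
      case True
      then show False
        using gen_lucas_double_square_minus_1_even[OF assms(1,2) \<open>j > 0\<close> True c(1), of b] c(2)
        unfolding V_def m by simp
    next
      case False
      then show False
        using gen_lucas_double_square_minus_1_odd[OF assms(1,2) P5 \<open>j > 0\<close> False c(1), of b] c(2)
        unfolding V_def m by simp
    qed
  qed
qed

section \<open>The three cases together\<close>

theorem theorem3p5:
  fixes P :: int
  assumes "P > 0"
  shows "(odd P \<and> 5 dvd P \<longrightarrow>
           (\<forall>n::nat. n \<ge> 1 \<longrightarrow>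
              ((\<exists>x::int. gen_fib P n = 5 * x^2) \<longleftrightarrow> n = 2 \<and> (\<exists>a::int. P = 5 * a^2)))) \<and>
         ([P^2 = 1] (mod 5) \<longrightarrow>
           (\<forall>n::nat. n \<ge> 1 \<longrightarrow>
              ((\<exists>x::int. gen_fib P n = 5 * x^2) \<longleftrightarrow> n = 5 \<and> P = 1))) \<and>
         (odd P \<and> [P^2 = -1] (mod 5) \<longrightarrow>
           \<not> (\<exists>n::nat. \<exists>x::int. n \<ge> 1 \<and> gen_fib P n = 5 * x^2))"
proof (intro conjI impI allI)
  fix n :: nat
  assume P: "odd P \<and> 5 dvd P" and n: "n \<ge> 1"
  show "(\<exists>x::int. gen_fib P n = 5 * x^2) \<longleftrightarrow> n = 2 \<and> (\<exists>a::int. P = 5 * a^2)"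
  proof
    assume "\<exists>x::int. gen_fib P n = 5 * x^2"
    then obtain x where x: "gen_fib P n = 5 * x^2" by blast
    then have "n = 2" using gen_fib_eq_5_square_multiple_5 assms P n by blast
    then show "n = 2 \<and> (\<exists>a::int. P = 5 * a^2)" using x by (auto simp: numeral_2_eq_2)
  qed (auto simp: numeral_2_eq_2)
next
  fix n :: nat
  assume P: "[P^2 = 1] (mod 5)" and n: "n \<ge> 1"
  show "(\<exists>x::int. gen_fib P n = 5 * x^2) \<longleftrightarrow> n = 5 \<and> P = 1"
  proof
    assume "n = 5 \<and> P = 1"
    then have "gen_fib P n = 5 * 1^2" by (simp add: eval_nat_numeral)
    then show "\<exists>x::int. gen_fib P n = 5 * x^2" by blast
  qed (use gen_fib_eq_5_square_unit_residue assms P n in blast)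
next
  assume "odd P \<and> [P^2 = -1] (mod 5)"
  then show "\<not> (\<exists>n::nat. \<exists>x::int. n \<ge> 1 \<and> gen_fib P n = 5 * x^2)"
    using gen_fib_ne_5_square_minus_unit_residue assms by blast
qed

end
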